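(* If $G$ is a $(0,3,6)$-fullerene with $s$ semiedges, then the spectrum of $G$ may be partitioned as $\{M,L,-L\}$ where one of the following holds: (a) $s=0$ and $M = \{3,-1,-1,-1\}$; (b) $s=2$ and $M = \{3,-1\}$; (c) $s=3$ and $M = \{3\}$; or (d) $s=4$ and $M = \{3,1\}$.
   Context: A semiedge of a graph is an edge with one endpoint; it contributes one to the valency of its endpoint and one to the corresponding diagonal entry of the adjacency matrix, and in a plane embedding it sits in a face and contributes one to that face's length. A $(0,3,6)$-fullerene is a cubic plane graph, possibly with semiedges, whose faces have sizes 3 and 6. The spectrum of a graph is the multiset of eigenvalues of its adjacency matrix. Here $L$ is a multiset of nonnegative real numbers and $-L$ is the multiset of their negatives.
   Formalization: The graph is assumed finite, nonempty and connected; without connectedness the claim fails, e.g. for two disjoint copies of K4 drawn side by side, whose common face has size 6 and whose spectrum is {3,3,-1,-1,-1,-1,-1,-1}. *)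

theory Defs
  imports
    "Jordan_Normal_Form.Char_Poly"
    "HOL-Combinatorics.Orbits"
    "HOL-Library.Countable_Set"
begin

text \<open>
  A graph embedded in a closed oriented surface, given by its rotation system. A \<^emph>\<open>dart\<close> is an
  edge together with a direction of traversal, starting at its \<^term>\<open>tail\<close>; \<^term>\<open>opp\<close> reverses the
  direction. An ordinary edge (loops and parallel edges are allowed) consists of two darts exchanged
  by \<^term>\<open>opp\<close>; a semiedge is a single dart fixed by \<^term>\<open>opp\<close>. The map \<^term>\<open>rot\<close> gives, for each
  dart, the next one in the cyclic order around its tail.
\<close>

record ('v, 'd) embedded_graph =
  verts :: "'v set"
  darts :: "'d set"
  tail :: "'d \<Rightarrow> 'v"
  opp :: "'d \<Rightarrow> 'd"
  rot :: "'d \<Rightarrow> 'd"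

definition darts_at :: "('v, 'd) embedded_graph \<Rightarrow> 'v \<Rightarrow> 'd set" where
  "darts_at G v = {d \<in> darts G. tail G d = v}"

definition wf_embedded_graph :: "('v, 'd) embedded_graph \<Rightarrow> bool" where
  "wf_embedded_graph G \<longleftrightarrow>
     finite (verts G) \<and> finite (darts G) \<and>
     (\<forall>d\<in>darts G. tail G d \<in> verts G) \<and>
     (\<forall>d\<in>darts G. opp G d \<in> darts G \<and> opp G (opp G d) = d) \<and>
     (\<forall>d\<in>darts G. orbit (rot G) d = darts_at G (tail G d))"

definition semiedges :: "('v, 'd) embedded_graph \<Rightarrow> 'd set" where
  "semiedges G = {d \<in> darts G. opp G d = d}"

definition edges :: "('v, 'd) embedded_graph \<Rightarrow> 'd set set" where
  "edges G = {{d, opp G d} | d. d \<in> darts G \<and> opp G d \<noteq> d}"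

text \<open>
  A face is identified with the set of darts on its boundary walk: after traversing \<^term>\<open>d\<close>, the walk
  continues with the successor of the reversal of \<^term>\<open>d\<close> at the vertex reached. The cardinality of this set is the
  length of the face: every side of an ordinary edge contributes one (so an edge with the same face
  on both sides contributes two), and a semiedge contributes one.
\<close>

definition faces :: "('v, 'd) embedded_graph \<Rightarrow> 'd set set" where
  "faces G = orbit (rot G \<circ> opp G) ` darts G"

definition graph_connected :: "('v, 'd) embedded_graph \<Rightarrow> bool" where
  "graph_connected G \<longleftrightarrow>
     verts G \<noteq> {} \<and>
     (\<forall>u\<in>verts G. \<forall>v\<in>verts G. (u, v) \<in> {(tail G d, tail G (opp G d)) | d. d \<in> darts G}\<^sup>*)"

text \<open>
  A connected graph with at least one dart is embedded in the sphere iff its Euler characteristic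
  is 2. Semiedges do not subdivide faces and are not counted as edges here.
\<close>

definition plane_graph :: "('v, 'd) embedded_graph \<Rightarrow> bool" where
  "plane_graph G \<longleftrightarrow>
     wf_embedded_graph G \<and> graph_connected G \<and>
     int (card (verts G)) - int (card (edges G)) + int (card (faces G)) = 2"

definition cubic :: "('v, 'd) embedded_graph \<Rightarrow> bool" where
  "cubic G \<longleftrightarrow> (\<forall>v\<in>verts G. card (darts_at G v) = 3)"

definition fullerene_036 :: "('v, 'd) embedded_graph \<Rightarrow> bool" where
  "fullerene_036 G \<longleftrightarrow> plane_graph G \<and> cubic G \<and> (\<forall>f\<in>faces G. card f = 3 \<or> card f = 6)"

text \<open>
  The vertices are listed in an arbitrary order, by the library's enumeration of the finite set
  \<^term>\<open>verts G\<close>; the spectrum does not depend on it.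
\<close>

definition adjacency_matrix :: "('v, 'd) embedded_graph \<Rightarrow> real mat" where
  "adjacency_matrix G =
     mat (card (verts G)) (card (verts G))
       (\<lambda>(i, j). real (card {d \<in> darts_at G (from_nat_into (verts G) i).
                               tail G (opp G d) = from_nat_into (verts G) j}))"

text \<open>
  Eigenvalues with multiplicity; the adjacency matrix is real symmetric, so all of them are real.
\<close>

definition graph_spectrum :: "('v, 'd) embedded_graph \<Rightarrow> real multiset" where
  "graph_spectrum G = proots (char_poly (adjacency_matrix G))"

end

theory Submission
  imports Defs "Jordan_Normal_Form.Schur_Decomposition"
begin

text \<open>
  On the darts, write \<open>r\<close> for the rotation and \<open>a\<close> for the reversal. Since vertices have degree 3 and
  faces have length 3 or 6, \<open>r\<^sup>3 = a\<^sup>2 = (r a)\<^sup>6 = 1\<close>, the relations of the rotation group of the hexagonal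
  lattice, where the three conjugates of \<open>a\<close> by powers of \<open>r\<close> act as half-turns. A closed walk of
  odd length \<open>k\<close> is a fixed dart of a product of \<open>k\<close> such half-turns. Such a product is again a
  half-turn, conjugate to \<open>a\<close> (whose fixed darts are the \<open>s\<close> semiedges) or to \<open>(r a)\<^sup>3\<close> (whose fixed
  darts are those on the triangular faces), depending only on the parities with which the three generators
  occur. Euler's formula says that \<open>s\<close> plus the number of triangles is 4, and counting words by
  parities gives \<open>tr A\<^sup>k = 3\<^sup>k - 3 + s\<close> for all odd \<open>k\<close>. Odd power sums determine a multiset of reals up
  to pairs \<open>x, -x\<close> and zeros.
\<close>

section \<open>Words in half-turns of the hexagonal lattice\<close>

definition fixed_points :: "'a set \<Rightarrow> ('a \<Rightarrow> 'a) \<Rightarrow> 'a set" where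
  "fixed_points D f = {d \<in> D. f d = d}"

lemma card_fixed_points_conj:
  assumes g: "bij_betw g D D" and gf: "\<And>d. d \<in> D \<Longrightarrow> f' (g d) = g (f d)"
    and f: "\<And>d. d \<in> D \<Longrightarrow> f d \<in> D"
  shows "card (fixed_points D f') = card (fixed_points D f)"
proof -
  have inj: "inj_on g D" and im: "g ` D = D" using g by (auto simp: bij_betw_def)
  have "g ` fixed_points D f = fixed_points D f'"
  proof (intro equalityI subsetI)
    fix y assume "y \<in> g ` fixed_points D f"
    then show "y \<in> fixed_points D f'" using gf im by (auto simp: fixed_points_def)
  next
    fix y assume y: "y \<in> fixed_points D f'"
    then obtain d where d: "d \<in> D" "y = g d" using im by (auto simp: fixed_points_def)
    then have "g (f d) = g d" using y gf by (auto simp: fixed_points_def)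
    then have "f d = d" using inj f d by (auto dest: inj_onD)
    then show "y \<in> g ` fixed_points D f" using d by (auto simp: fixed_points_def)
  qed
  moreover have "inj_on g (fixed_points D f)"
    using inj by (rule inj_on_subset) (auto simp: fixed_points_def)
  ultimately show ?thesis by (metis card_image)
qed

text \<open>For a word of odd length over the letters 0, 1, 2 the three counts have an odd sum, so
  either all of them are odd or exactly one is.\<close>

definition all_odd :: "nat list \<Rightarrow> bool" where
  "all_odd w \<longleftrightarrow> (\<forall>p<3. odd (count_list w p))"

text \<open>The group relations are demanded off \<open>D\<close> as well, so that they rewrite
  unconditionally; only the closure conditions and \<open>no_monogon\<close> are relative to
  \<open>D\<close>.\<close>

locale hexagonal_action =
  fixes D :: "'d set" and r a :: "'d \<Rightarrow> 'd"
  assumes finite_D: "finite D"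
    and r_in: "d \<in> D \<Longrightarrow> r d \<in> D"
    and a_in: "d \<in> D \<Longrightarrow> a d \<in> D"
    and r_cubed: "r (r (r d)) = d"
    and a_squared: "a (a d) = d"
    and ra_sixth: "((r \<circ> a) ^^ 6) d = d"
    and no_monogon: "d \<in> D \<Longrightarrow> r (a d) \<noteq> d"
begin

text \<open>
  A conjugate of \<open>a\<close>, as \<open>r ^ (2 p)\<close> is the inverse of \<open>r ^ p\<close>; the index only matters modulo 3.
\<close>

definition half_turn :: "nat \<Rightarrow> 'd \<Rightarrow> 'd" where
  "half_turn p d = (r ^^ (2 * p)) (a ((r ^^ p) d))"

abbreviation half_turns :: "nat list \<Rightarrow> 'd \<Rightarrow> 'd" where
  "half_turns w \<equiv> fold half_turn w"

lemma r_pow_mod: "(r ^^ (n mod 3)) d = (r ^^ n) d"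
  by (rule funpow_mod_eq) (simp add: numeral_3_eq_3 r_cubed)

lemma half_turn_mod: "half_turn (p mod 3) = half_turn p"
proof
  fix d
  have "(r ^^ (2 * (p mod 3))) e = (r ^^ (2 * p)) e" for e
    using r_pow_mod[of "2 * (p mod 3)" e] r_pow_mod[of "2 * p" e]
    by (simp add: mod_mult_right_eq)
  then show "half_turn (p mod 3) d = half_turn p d"
    by (simp add: half_turn_def r_pow_mod)
qed

lemma half_turn_cong: "p mod 3 = q mod 3 \<Longrightarrow> half_turn p = half_turn q"
  by (metis half_turn_mod)

lemma half_turn_0: "half_turn 0 d = a d"
  and half_turn_1: "half_turn (Suc 0) d = r (r (a (r d)))"
  and half_turn_2: "half_turn (Suc (Suc 0)) d = r (a (r (r d)))"
  by (simp_all add: half_turn_def numeral_eq_Suc r_cubed)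

lemma half_turn_cases:
  obtains "half_turn p = half_turn 0" | "half_turn p = half_turn (Suc 0)" | "half_turn p = half_turn (Suc (Suc 0))"
proof -
  have "p mod 3 = 0 \<or> p mod 3 = 1 \<or> p mod 3 = 2" by linarith
  then show thesis using half_turn_mod[of p] that by (auto simp: numeral_2_eq_2)
qed

lemma half_turn_half_turn [simp]: "half_turn p (half_turn p d) = d"
  by (rule half_turn_cases[of p]) (simp_all add: half_turn_0 half_turn_1 half_turn_2 r_cubed a_squared)

lemma half_turn_r: "half_turn p (r d) = r (half_turn (Suc p) d)"
  by (simp add: half_turn_def funpow_swap1 r_cubed)

lemma half_turn_in: "d \<in> D \<Longrightarrow> half_turn p d \<in> D"
  by (rule half_turn_cases[of p]) (simp_all add: half_turn_0 half_turn_1 half_turn_2 r_in a_in)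

lemma half_turns_in: "d \<in> D \<Longrightarrow> half_turns w d \<in> D"
  by (induction w arbitrary: d) (auto simp: half_turn_in)

lemma half_turn_bij: "bij_betw (half_turn p) D D"
  by (rule bij_betw_byWitness[where f' = "half_turn p"]) (auto simp: half_turn_in)

lemma r_bij: "bij_betw r D D"
  by (rule bij_betw_byWitness[where f' = "r \<circ> r"]) (auto simp: r_in r_cubed)

text \<open>The right-hand side spells out the inverse of \<open>(r \<circ> a) ^^ 3\<close>, with
  \<open>r \<circ> r\<close> as the inverse of \<open>r\<close>; the two agree because
  \<open>(r \<circ> a) ^^ 6\<close> is the identity.\<close>

lemma ra_cubed_self_inverse:
  "r (a (r (a (r (a d))))) = a (r (r (a (r (r (a (r (r d))))))))"
proof -
  define y where "y = a (r (r (a (r (r (a (r (r d))))))))"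
  have "r (a (r (a (r (a y))))) = d" by (simp add: y_def r_cubed a_squared)
  then show ?thesis using ra_sixth[of y]
    by (simp add: numeral_eq_Suc y_def)
qed

text \<open>Expanded in \<open>r\<close> and \<open>a\<close>, the left side is the inverse of
  \<open>(r \<circ> a) ^^ 3\<close> and the right side is \<open>(r \<circ> a) ^^ 3\<close>
  itself.\<close>

lemma half_turn_012: "half_turn 0 (half_turn (Suc 0) (half_turn (Suc (Suc 0)) d)) = half_turn (Suc (Suc 0)) (half_turn (Suc 0) (half_turn 0 d))"
  by (simp add: half_turn_0 half_turn_1 half_turn_2 r_cubed ra_cubed_self_inverse)

text \<open>The composition of three half-turns is a half-turn, hence equal to its inverse.\<close>

lemma half_turn_triple: "half_turn i (half_turn j (half_turn k d)) = half_turn k (half_turn j (half_turn i d))"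
proof -
  let ?x = "half_turn 0" and ?y = "half_turn (Suc 0)" and ?z = "half_turn (Suc (Suc 0))"
  have 1: "?x (?y (?z e)) = ?z (?y (?x e))" for e by (rule half_turn_012)
  \<comment> \<open>The three equations cover the choices of middle letter among distinct letters;
    triples with a repetition follow by cancellation or reflexivity.\<close>
  have 2: "?y (?z (?x e)) = ?x (?z (?y e))" for e
    using 1[of "?x e"] by (metis half_turn_half_turn)
  have 3: "?y (?x (?z e)) = ?z (?x (?y e))" for e
    using 1[of "?z e"] by (metis half_turn_half_turn)
  show ?thesis
    by (rule half_turn_cases[of i]; rule half_turn_cases[of j]; rule half_turn_cases[of k])
       (simp_all add: 1 2 3)
qed

text \<open>\<open>fold\<close> applies the leftmost letter first. On the first three letters
  \<open>half_turn_triple\<close> turns \<open>j, p, q\<close> into \<open>q, p, j\<close>; doing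
  the same on both sides leaves a common start \<open>q, p\<close> and a middle part shorter by
  two.\<close>

lemma half_turns_swap_ends:
  assumes "odd (length z)"
  shows "half_turns (j # z @ [i]) = half_turns (i # z @ [j])"
  using assms
proof (induction "length z" arbitrary: z rule: less_induct)
  case less
  then obtain p z1 where z1: "z = p # z1" by (cases z) auto
  show ?case
  proof (cases z1)
    case Nil
    then show ?thesis using z1 by (auto simp: fun_eq_iff half_turn_triple)
  next
    case (Cons q z2)
    have IH: "half_turns (j # z2 @ [i]) = half_turns (i # z2 @ [j])"
      using less z1 Cons by simp
    have 1: "half_turns (j # z @ [i]) d = half_turns (j # z2 @ [i]) (half_turn p (half_turn q d))" for d
      using z1 Cons half_turn_triple[of q p j d] by simp
    have 2: "half_turns (i # z @ [j]) d = half_turns (i # z2 @ [j]) (half_turn p (half_turn q d))" for d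
      using z1 Cons half_turn_triple[of q p i d] by simp
    show ?thesis by (rule ext) (simp only: 1 2 IH)
  qed
qed

section \<open>Fixed darts of words of odd length\<close>

lemma card_fixed_rotate:
  "card (fixed_points D (half_turns (w @ [p]))) = card (fixed_points D (half_turns (p # w)))"
  by (rule card_fixed_points_conj[OF half_turn_bij[of p]]) (auto simp: half_turns_in half_turn_in)

lemma card_fixed_rotate_append:
  "card (fixed_points D (half_turns (u @ v))) = card (fixed_points D (half_turns (v @ u)))"
proof (induction u arbitrary: v)
  case (Cons p u)
  show ?case using Cons[of "v @ [p]"] card_fixed_rotate[of "u @ v" p] by (simp add: comp_def)
qed simp

text \<open>A cyclic rotation of the word brings \<open>j\<close> to the front and \<open>i\<close>
  to the end, with a middle part of odd length between them, so the ends can be exchanged.\<close>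

lemma card_fixed_swap:
  assumes "odd (length (u @ i # j # v))"
  shows "card (fixed_points D (half_turns (u @ i # j # v))) = card (fixed_points D (half_turns (u @ j # i # v)))"
proof -
  have "card (fixed_points D (half_turns (u @ i # j # v))) = card (fixed_points D (half_turns (j # (v @ u) @ [i])))"
    using card_fixed_rotate_append[of "u @ [i]" "j # v"] by simp
  also have "half_turns (j # (v @ u) @ [i]) = half_turns (i # (v @ u) @ [j])"
    by (rule half_turns_swap_ends) (use assms in auto)
  also have "card (fixed_points D (half_turns (i # (v @ u) @ [j]))) = card (fixed_points D (half_turns (u @ j # i # v)))"
    using card_fixed_rotate_append[of "u @ [j]" "i # v"] by simp
  finally show ?thesis .
qed

text \<open>Adjacent swaps carry the first \<open>p\<close> to the right through \<open>u\<close>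
  until it meets the second one, where the two cancel.\<close>

lemma card_fixed_cancel:
  assumes "odd (length (c @ p # u @ p # v))"
  shows "card (fixed_points D (half_turns (c @ p # u @ p # v))) = card (fixed_points D (half_turns (c @ u @ v)))"
  using assms
proof (induction u arbitrary: c)
  case Nil
  have "half_turns (c @ p # p # v) d = half_turns (c @ v) d" for d by simp
  then show ?case by (auto simp: fixed_points_def)
next
  case (Cons q u)
  have "card (fixed_points D (half_turns (c @ p # (q # u) @ p # v)))
      = card (fixed_points D (half_turns ((c @ [q]) @ p # u @ p # v)))"
    using card_fixed_swap[of c p q "u @ p # v"] Cons.prems by simp
  also have "\<dots> = card (fixed_points D (half_turns ((c @ [q]) @ u @ v)))"
    by (rule Cons.IH) (use Cons.prems in auto)
  finally show ?case by (simp only: append.simps append_assoc)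
qed

text \<open>By \<open>half_turn_r\<close>, consecutive half-turns are conjugate under
  \<open>r\<close>.\<close>

lemma card_fixed_half_turn: "card (fixed_points D (half_turn p)) = card (fixed_points D a)"
proof -
  have "card (fixed_points D (half_turn p)) = card (fixed_points D (half_turn (Suc p)))" for p
    by (rule card_fixed_points_conj[OF r_bij]) (auto simp: half_turn_r half_turn_in)
  then have "card (fixed_points D (half_turn p)) = card (fixed_points D (half_turn 0))"
    by (induction p) auto
  then show ?thesis by (simp add: half_turn_0[abs_def])
qed

lemma half_turns_012: "half_turns [0, Suc 0, Suc (Suc 0)] d = r (a (r (a (r (a d)))))"
  by (simp add: half_turn_0 half_turn_1 half_turn_2 r_cubed)

text \<open>Cancelling a repeated letter preserves all parities. What remains is a word of odd
  length with distinct letters: a single half-turn, conjugate to \<open>a\<close>, or an arrangement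
  of 0, 1, 2, which can be sorted and then equals \<open>(r \<circ> a) ^^ 3\<close>.\<close>

lemma card_fixed_half_turns:
  assumes "odd (length w)" "set w \<subseteq> {..<3}"
  shows "card (fixed_points D (half_turns w)) =
    (if all_odd w then card (fixed_points D ((r \<circ> a) ^^ 3)) else card (fixed_points D a))"
  using assms
proof (induction "length w" arbitrary: w rule: less_induct)
  case less
  show ?case
  proof (cases "distinct w")
    case False
    then obtain c p u v where w: "w = c @ [p] @ u @ [p] @ v"
      using not_distinct_decomp by blast
    have "card (fixed_points D (half_turns w)) = card (fixed_points D (half_turns (c @ u @ v)))"
      using card_fixed_cancel[of c p u v] less.prems w by simp
    also have "\<dots> = (if all_odd (c @ u @ v) then card (fixed_points D ((r \<circ> a) ^^ 3))
        else card (fixed_points D a))"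
      by (rule less.hyps) (use w less.prems in auto)
    also have "all_odd (c @ u @ v) = all_odd w"
      using w by (auto simp: all_odd_def)
    finally show ?thesis .
  next
    case True
    have "length w \<le> 3"
      using card_mono[OF _ less.prems(2)] distinct_card[OF True] by simp
    then consider "length w = 1" | "length w = 3"
      using less.prems(1) by (cases "length w"; force simp: numeral_eq_Suc le_Suc_eq)
    then show ?thesis
    proof cases
      case 1
      then obtain p where w: "w = [p]" by (cases w) auto
      have "\<not> all_odd w"
      proof
        assume "all_odd w"
        then have "odd (count_list w 0)" "odd (count_list w 1)" unfolding all_odd_def by simp_all
        then show False using w by (simp split: if_splits)
      qed
      then show ?thesis using w card_fixed_half_turn[of p] by simp
    next
      case 2
      then obtain i j k where w: "w = [i, j, k]"
        by (auto simp: numeral_3_eq_3 length_Suc_conv)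
      have lt: "i \<in> {0, 1, 2}" "j \<in> {0, 1, 2}" "k \<in> {0, 1, 2}"
        using less.prems w by auto
      have odd: "all_odd w"
        using lt True w by (auto simp: all_odd_def numeral_3_eq_3 less_Suc_eq)
      let ?c = "\<lambda>i j k. card (fixed_points D (half_turns [i, j, k]))"
      \<comment> \<open>Adjacent transpositions reach all six orders of the letters.\<close>
      have sw: "?c i j k = ?c j i k" "?c i j k = ?c i k j" for i j k
        using card_fixed_swap[of "[]" i j "[k]"] card_fixed_swap[of "[i]" j k "[]"] by auto
      have "?c i j k = ?c 0 1 2"
        using lt True w sw[of 0 1 2] sw[of 0 2 1] sw[of 1 0 2] sw[of 1 2 0] sw[of 2 0 1] sw[of 2 1 0]
        by auto
      moreover have "half_turns [0, 1, 2] = (r \<circ> a) ^^ 3"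
        using half_turns_012 by (simp add: numeral_2_eq_2 numeral_3_eq_3 fun_eq_iff)
      ultimately show ?thesis using odd w by simp
    qed
  qed
qed

text \<open>
  An odd product of half-turns followed or preceded by \<open>r\<close> is a rotation of order 6. All of these are
  conjugate to \<open>r a\<close> or its inverse, which has no fixed dart. The reduction moves letters around the
  word cyclically; passing through \<open>r\<close> shifts an index by one.
\<close>

definition turns :: "nat list \<Rightarrow> bool" where
  "turns w \<longleftrightarrow> (\<exists>d\<in>D. half_turns w (r d) = d)"

lemma turns_rotate: "turns (p # w) \<longleftrightarrow> turns (w @ [Suc p])"
proof
  assume "turns (p # w)"
  then obtain d where d: "d \<in> D" "half_turns w (half_turn p (r d)) = d" by (auto simp: turns_def)
  then have "half_turns (w @ [Suc p]) (r (half_turn (Suc p) d)) = half_turn (Suc p) d" by (simp add: half_turn_r)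
  then show "turns (w @ [Suc p])" using d half_turn_in unfolding turns_def by blast
next
  assume "turns (w @ [Suc p])"
  then obtain d where d: "d \<in> D" "half_turn (Suc p) (half_turns w (r d)) = d" by (auto simp: turns_def)
  have "half_turns (p # w) (r (half_turn (Suc p) d)) = half_turns w (r d)" by (simp add: half_turn_r)
  also have "\<dots> = half_turn (Suc p) d" using d(2) by (metis half_turn_half_turn)
  finally show "turns (p # w)" using d half_turn_in unfolding turns_def by blast
qed

lemma turns_cancel: "half_turn i = half_turn j \<Longrightarrow> turns (i # j # w) \<longleftrightarrow> turns w"
  by (simp add: turns_def)

text \<open>Rotated to the end, \<open>i\<close> becomes \<open>i + 1\<close>; exchanged with
  \<open>j\<close> and rotated again it becomes \<open>i + 2\<close>, which equals \<open>j\<close>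
  modulo 3 and cancels with it.\<close>

lemma turns_descent:
  assumes "odd (length w)" "j mod 3 = (i + 2) mod 3"
  shows "turns (i # j # w) \<longleftrightarrow> turns w"
proof -
  have "turns (i # j # w) \<longleftrightarrow> turns (j # w @ [Suc i])" using turns_rotate[of i "j # w"] by simp
  also have "\<dots> \<longleftrightarrow> turns (Suc i # w @ [j])"
    using half_turns_swap_ends[OF assms(1), of j "Suc i"] by (simp add: turns_def)
  also have "\<dots> \<longleftrightarrow> turns (Suc i # w @ [Suc (Suc i)])"
  proof -
    have "half_turn j = half_turn (Suc (Suc i))" by (rule half_turn_cong) (use assms(2) in simp)
    then show ?thesis by (simp add: turns_def)
  qed
  also have "\<dots> \<longleftrightarrow> turns (w @ [Suc (Suc i), Suc (Suc i)])"
    using turns_rotate[of "Suc i" "w @ [Suc (Suc i)]"] by simp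
  also have "\<dots> \<longleftrightarrow> turns w" by (simp add: turns_def)
  finally show ?thesis .
qed

lemma not_turns_singleton: "\<not> turns [p]"
proof (induction p)
  case 0
  \<comment> \<open>From \<open>a (r d) = d\<close> follows \<open>r (a (r d)) = r d\<close>,
    against \<open>no_monogon\<close> at \<open>r d\<close>.\<close>
  show ?case using no_monogon r_in by (fastforce simp: turns_def half_turn_0)
next
  case (Suc p)
  then show ?case using turns_rotate[of p "[]"] by simp
qed

text \<open>Two letters are removed at a time. If \<open>j\<close> is \<open>i\<close> or
  \<open>i + 2\<close> modulo 3, the first two go. Otherwise \<open>j\<close> is
  \<open>i + 1\<close>, and the same is tried on \<open>j, k\<close> after rotating \<open>i\<close>
  to the end, which leaves only the case that \<open>i, j, k\<close> increase in steps of
  one.\<close>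

lemma not_turns:
  assumes "odd (length w)"
  shows "\<not> turns w"
  using assms
proof (induction "length w" arbitrary: w rule: less_induct)
  case less
  show ?case
  proof (cases "length w = 1")
    case True
    then show ?thesis using not_turns_singleton by (cases w) auto
  next
    case False
    then obtain i j k v where w: "w = i # j # k # v"
      using less.prems by (cases w; cases "tl w"; cases "tl (tl w)") auto
    have kv: "odd (length (k # v))" and v: "odd (length (v @ [Suc i]))" using less.prems w by auto
    have IH: "\<not> turns (k # v)" "\<not> turns (v @ [Suc i])"
      using less.hyps[OF _ kv] less.hyps[OF _ v] w by auto
    have m3: "q mod 3 = p mod 3 \<or> q mod 3 = (p + 1) mod 3 \<or> q mod 3 = (p + 2) mod 3" for p q :: nat
      using mod_less_divisor[of 3 q] mod_less_divisor[of 3 p] by (simp add: mod_Suc) linarith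
    consider "j mod 3 = i mod 3" | "j mod 3 = (i + 2) mod 3"
      | "j mod 3 = (i + 1) mod 3" "k mod 3 = j mod 3"
      | "j mod 3 = (i + 1) mod 3" "k mod 3 = (j + 2) mod 3"
      | "j mod 3 = (i + 1) mod 3" "k mod 3 = (j + 1) mod 3"
      using m3[of j i] m3[of k j] by blast
    then show ?thesis
    proof cases
      case 1
      then show ?thesis using turns_cancel[OF half_turn_cong, of i j] IH w by simp
    next
      case 2
      then show ?thesis using turns_descent[OF kv, of j i] IH w by simp
    next
      case 3
      have "turns w \<longleftrightarrow> turns (j # k # v @ [Suc i])" using w turns_rotate[of i "j # k # v"] by simp
      then show ?thesis using turns_cancel[OF half_turn_cong, of j k] 3 IH by simp
    next
      case 4
      have "turns w \<longleftrightarrow> turns (j # k # v @ [Suc i])" using w turns_rotate[of i "j # k # v"] by simp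
      then show ?thesis using turns_descent[OF v, of k j] 4 IH by simp
    next
      case 5
      \<comment> \<open>Reversing the triple makes it decrease in steps of one, so
        \<open>turns_descent\<close> applies to \<open>k, j\<close>.\<close>
      have "turns w \<longleftrightarrow> turns (k # j # i # v)"
        using w by (simp add: turns_def half_turn_triple[of k])
      moreover have "j mod 3 = (k + 2) mod 3" using 5 by (auto simp: mod_Suc split: if_splits)
      ultimately show ?thesis
        using turns_descent[of "i # v" j k] less.hyps[of "i # v"] less.prems w by simp
    qed
  qed
qed

text \<open>Consequence for walks: a walk of odd length that returns to its starting vertex returns
  to its starting dart. The reversed word is the inverse map, which handles \<open>r d\<close>; for
  \<open>r (r d)\<close>, that dart itself would witness \<open>turns w\<close>.\<close>

lemma half_turns_neq_r:
  assumes "odd (length w)" "d \<in> D"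
  shows "half_turns w d \<noteq> r d" "half_turns w d \<noteq> r (r d)"
proof -
  have inv: "half_turns (rev w) (half_turns w e) = e" for e
    by (induction w arbitrary: e) auto
  show "half_turns w d \<noteq> r d"
    using not_turns[of "rev w"] assms inv[of d] by (auto simp: turns_def)
  show "half_turns w d \<noteq> r (r d)"
  proof
    assume "half_turns w d = r (r d)"
    then have "half_turns w (r (r (r d))) = r (r d)" by (simp add: r_cubed)
    then show False using not_turns[OF assms(1)] assms(2) r_in unfolding turns_def by blast
  qed
qed

end

section \<open>Counting words by the parities of their letters\<close>

definition words :: "nat \<Rightarrow> nat list set" where
  "words k = {w. set w \<subseteq> {..<3} \<and> length w = k}"

lemma card_words: "card (words k) = 3 ^ k"
  unfolding words_def by (subst card_lists_length_eq) simp_all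

lemma sum_words_Suc:
  "(\<Sum>w\<in>words (Suc k). f w) = (\<Sum>w\<in>words k. \<Sum>p<3. f (w @ [p]))"
proof -
  have "(\<Sum>w\<in>words (Suc k). f w) = (\<Sum>(w, p)\<in>words k \<times> {..<3}. f (w @ [p]))"
  proof (rule sum.reindex_bij_witness[where i = "\<lambda>(w, p). w @ [p]" and j = "\<lambda>w. (butlast w, last w)"])
    fix w assume w: "w \<in> words (Suc k)"
    then have "w \<noteq> []" by (auto simp: words_def)
    then show "(\<lambda>(w, p). w @ [p]) (butlast w, last w) = w"
      "(butlast w, last w) \<in> words k \<times> {..<3}"
      "(\<lambda>(w, p). f (w @ [p])) (butlast w, last w) = f w"
      using w subsetD[OF _ last_in_set, of w] in_set_butlastD[of _ w] by (auto simp: words_def)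
  qed (auto simp: words_def)
  then show ?thesis by (simp add: sum.cartesian_product)
qed

text \<open>Appending a letter multiplies the sum by the total sign of the three letters, which is
  \<open>1 + 1 - 1 = 1\<close>.\<close>

lemma sum_sign_words:
  assumes "p < 3"
  shows "(\<Sum>w\<in>words k. (- 1) ^ count_list w p) = (1 :: int)"
proof (induction k)
  case 0
  have "words 0 = {[]}" by (auto simp: words_def)
  then show ?case by simp
next
  case (Suc k)
  have "p = 0 \<or> p = 1 \<or> p = 2" using assms by linarith
  then show ?case
    using Suc by (auto simp: sum_words_Suc numeral_3_eq_3 numeral_2_eq_2 sum_negf)
qed

lemma length_eq_counts:
  "set w \<subseteq> {..<3 :: nat} \<Longrightarrow> length w = count_list w 0 + count_list w 1 + count_list w 2"
  by (induction w) (auto simp: numeral_3_eq_3 less_Suc_eq)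

text \<open>Since the length is odd, the three signs sum to -3 if all counts are odd and to 1 if
  just one is.\<close>

lemma all_odd_sign:
  assumes "w \<in> words k" "odd k"
  shows "4 * of_bool (all_odd w) = (1 - (\<Sum>p<3. (- 1) ^ count_list w p) :: int)"
proof -
  have "odd (count_list w 0 + count_list w 1 + count_list w 2)"
    using assms length_eq_counts[of w] by (auto simp: words_def)
  moreover have "all_odd w \<longleftrightarrow> odd (count_list w 0) \<and> odd (count_list w 1) \<and> odd (count_list w 2)"
    by (auto simp: all_odd_def numeral_3_eq_3 less_Suc_eq numeral_2_eq_2)
  moreover have "(\<Sum>p<3. (- 1) ^ count_list w p)
      = ((- 1) ^ count_list w 0 + (- 1) ^ count_list w 1 + (- 1) ^ count_list w 2 :: int)"
    by (simp add: numeral_3_eq_3 numeral_2_eq_2)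
  ultimately show ?thesis
    by (cases "even (count_list w 0)"; cases "even (count_list w 1)"; cases "even (count_list w 2)") auto
qed

lemma card_all_odd_words:
  assumes "odd k"
  shows "4 * (\<Sum>w\<in>words k. of_bool (all_odd w)) = (3 ^ k - 3 :: int)"
proof -
  have "4 * (\<Sum>w\<in>words k. of_bool (all_odd w))
      = (\<Sum>w\<in>words k. 1 - (\<Sum>p<3. (- 1) ^ count_list w p) :: int)"
    by (subst sum_distrib_left) (rule sum.cong[OF refl all_odd_sign[OF _ assms]])
  also have "\<dots> = 3 ^ k - (\<Sum>p<3. \<Sum>w\<in>words k. (- 1) ^ count_list w p)"
    by (simp add: sum_subtractf card_words sum.swap[of _ "words k"])
  also have "\<dots> = 3 ^ k - 3" by (simp add: sum_sign_words)
  finally show ?thesis .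
qed

text \<open>Serves twice: for the reversal it relates darts, edges and semiedges, and for half-turns
  it gives a parity argument.\<close>

lemma card_involution:
  assumes "finite X" "\<And>x. x \<in> X \<Longrightarrow> f x \<in> X" "\<And>x. x \<in> X \<Longrightarrow> f (f x) = x"
  shows "card X = 2 * card {{x, f x} | x. x \<in> X \<and> f x \<noteq> x} + card (fixed_points X f)"
proof -
  let ?C = "{{x, f x} | x. x \<in> X \<and> f x \<noteq> x}"
  have U: "\<Union>?C = X - fixed_points X f"
  proof (intro equalityI subsetI)
    fix y assume "y \<in> \<Union>?C"
    then obtain x where "x \<in> X" "f x \<noteq> x" "y = x \<or> y = f x" by blast
    then show "y \<in> X - fixed_points X f"
      using assms(2,3)[of x] by (auto simp: fixed_points_def)
  next
    fix y assume "y \<in> X - fixed_points X f"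
    then show "y \<in> \<Union>?C" by (auto simp: fixed_points_def)
  qed
  have "2 * card ?C = card (\<Union>?C)"
  proof (rule card_partition)
    show "finite ?C" using assms(1) by simp
    show "finite (\<Union>?C)" unfolding U using assms(1) by simp
    show "card c = 2" if "c \<in> ?C" for c using that by auto
    show "c1 \<inter> c2 = {}" if "c1 \<in> ?C" "c2 \<in> ?C" "c1 \<noteq> c2" for c1 c2
    proof (rule ccontr)
      assume "c1 \<inter> c2 \<noteq> {}"
      then obtain z where z: "z \<in> c1" "z \<in> c2" by blast
      have "c = {z, f z}" if c: "c \<in> ?C" "z \<in> c" for c
      proof -
        obtain x where x: "x \<in> X" "c = {x, f x}" using c(1) by blast
        then have "z = x \<or> z = f x" using c(2) by blast
        then show ?thesis using x assms(3)[of x] by auto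
      qed
      then show False using z \<open>c1 \<in> ?C\<close> \<open>c2 \<in> ?C\<close> \<open>c1 \<noteq> c2\<close> by blast
    qed
  qed
  moreover have "card (X - fixed_points X f) + card (fixed_points X f) = card X"
    using assms(1) by (metis (no_types, lifting) card_Diff_subset card_mono finite_subset fixed_points_def
        le_add_diff_inverse2 mem_Collect_eq subsetI)
  ultimately show ?thesis using U by simp
qed

context hexagonal_action
begin

text \<open>Every word contributes \<open>?s\<close>, and each all-odd word \<open>?t - ?s\<close>
  more; the factor 4 avoids dividing the number of all-odd words.\<close>

lemma sum_card_fixed_half_turns:
  assumes "odd k"
  shows "4 * int (\<Sum>w\<in>words k. card (fixed_points D (half_turns w)))
    = 4 * 3 ^ k * int (card (fixed_points D a))
      + (int (card (fixed_points D ((r \<circ> a) ^^ 3))) - int (card (fixed_points D a))) * (3 ^ k - 3)"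
    (is "_ = 4 * _ * ?s + (?t - ?s) * _")
proof -
  have "int (card (fixed_points D (half_turns w))) = ?s + (?t - ?s) * of_bool (all_odd w)"
    if "w \<in> words k" for w
    using card_fixed_half_turns[of w] that assms by (auto simp: words_def)
  then have "int (\<Sum>w\<in>words k. card (fixed_points D (half_turns w)))
      = (\<Sum>w\<in>words k. ?s + (?t - ?s) * of_bool (all_odd w))"
    unfolding of_nat_sum by (rule sum.cong[OF refl])
  also have "\<dots> = 3 ^ k * ?s + (?t - ?s) * (\<Sum>w\<in>words k. of_bool (all_odd w))"
    by (simp only: sum.distrib sum_constant card_words sum_distrib_left) simp
  finally have "4 * int (\<Sum>w\<in>words k. card (fixed_points D (half_turns w)))
      = 4 * 3 ^ k * ?s + (?t - ?s) * (4 * (\<Sum>w\<in>words k. of_bool (all_odd w)))"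
    by (simp only: distrib_left mult_ac)
  then show ?thesis by (simp only: card_all_odd_words[OF assms])
qed

text \<open>
  If there were a unique semiedge \<open>d\<close>, its orbit under the half-turns would have odd size, so every
  half-turn would fix a dart of it. This puts \<open>r d\<close> into the orbit, and as \<open>a d = d\<close> it can be
  reached by a word of odd length.
\<close>

lemma card_fixed_a_neq_1: "card (fixed_points D a) \<noteq> 1"
proof
  assume one: "card (fixed_points D a) = 1"
  then obtain d where d: "fixed_points D a = {d}" by (auto simp: card_1_singleton_iff)
  then have dD: "d \<in> D" and ad: "a d = d" by (auto simp: fixed_points_def)
  define X where "X = {half_turns w d | w. True}"
  have XD: "X \<subseteq> D" using half_turns_in dD by (auto simp: X_def)
  have finX: "finite X" using XD finite_D by (rule finite_subset)
  have X: "half_turn p x \<in> X" if "x \<in> X" for x p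
  proof -
    obtain w where "x = half_turns w d" using \<open>x \<in> X\<close> by (auto simp: X_def)
    then have "half_turn p x = half_turns (w @ [p]) d" by simp
    then show ?thesis unfolding X_def by blast
  qed
  have dX: "d \<in> X" unfolding X_def by (auto intro!: exI[of _ "[]"])
  have parity: "even (card X) \<longleftrightarrow> even (card (fixed_points X (half_turn p)))" for p
    by (subst card_involution[OF finX, of "half_turn p"]) (auto simp: X)
  have "fixed_points X (half_turn 0) = {d}"
    using d dX XD by (auto simp: fixed_points_def half_turn_0)
  then have "odd (card X)" using parity[of 0] by simp
  then have "odd (card (fixed_points X (half_turn 2)))" using parity by blast
  then have "fixed_points X (half_turn 2) \<noteq> {}" by (metis card.empty even_zero)
  then obtain e where e: "e \<in> X" "r (a (r (r e))) = e"
    by (auto simp: fixed_points_def half_turn_2 numeral_2_eq_2)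
  \<comment> \<open>So \<open>r (r e)\<close> is fixed by \<open>a\<close> and must be
    \<open>d\<close>, which gives \<open>e = r d\<close>.\<close>
  have "a (r (r e)) = r (r e)" using e(2) r_cubed by metis
  then have "r (r e) \<in> fixed_points D a" using e XD r_in by (auto simp: fixed_points_def)
  then have "e = r d" using d r_cubed by (metis singletonD)
  then obtain w where w: "half_turns w d = r d" using e(1) by (auto simp: X_def)
  have w': "half_turns (0 # w) d = r d" using w ad by (simp add: half_turn_0)
  show False
    using half_turns_neq_r(1)[of w d] half_turns_neq_r(1)[of "0 # w" d] w w' dD
    by (cases "odd (length w)") auto
qed

end

section \<open>Odd power sums\<close>

lemma sum_mset_eq_sum_count:
  fixes f :: "'a \<Rightarrow> real"
  assumes "finite S" "set_mset X \<subseteq> S"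
  shows "(\<Sum>x\<in>#X. f x) = (\<Sum>x\<in>S. real (count X x) * f x)"
  using assms(2)
proof (induction X)
  case (add y X)
  have "(\<Sum>x\<in>S. real (count (add_mset y X) x) * f x)
      = (\<Sum>x\<in>S. real (count X x) * f x + (if x = y then f x else 0))"
    by (intro sum.cong) (auto simp: algebra_simps)
  also have "\<dots> = (\<Sum>x\<in>S. real (count X x) * f x) + f y"
    using add.prems assms(1) by (simp add: sum.distrib)
  finally show ?case using add by simp
qed simp

text \<open>Let \<open>m\<close> be the difference of multiplicities. Its odd moments vanish, so
  every odd polynomial sums to zero against \<open>m\<close>. The polynomial
  \<open>x * q (x^2)\<close>, with \<open>q\<close> vanishing at all squares of the support except
  \<open>l^2\<close>, isolates \<open>m l - m (- l)\<close>.\<close>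

lemma count_symmetric_of_odd_power_sums:
  fixes X M :: "real multiset"
  assumes sums: "\<And>k. odd k \<Longrightarrow> (\<Sum>x\<in>#X. x ^ k) = (\<Sum>x\<in>#M. x ^ k)" and "0 < l"
  shows "count X l + count M (- l) = count X (- l) + count M l"
proof -
  define S where "S = set_mset X \<union> set_mset M \<union> {l, - l}"
  have S: "finite S" "set_mset X \<subseteq> S" "set_mset M \<subseteq> S" "l \<in> S" "- l \<in> S" by (auto simp: S_def)
  define m where "m x = real (count X x) - real (count M x)" for x
  have odd0: "(\<Sum>x\<in>S. m x * x ^ k) = 0" if "odd k" for k
    using sums[OF that] sum_mset_eq_sum_count[OF S(1,2), of "\<lambda>x. x ^ k"]
      sum_mset_eq_sum_count[OF S(1,3), of "\<lambda>x. x ^ k"]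
    by (simp add: m_def left_diff_distrib sum_subtractf)
  define Y where "Y = (\<lambda>x. x ^ 2) ` S - {l ^ 2}"
  define q where "q = (\<Prod>y\<in>Y. [:- y, 1:])"
  have finY: "finite Y" using S(1) by (simp add: Y_def)
  have q: "poly q z = (\<Prod>y\<in>Y. z - y)" for z by (simp add: q_def poly_prod)
  have ql: "poly q (l ^ 2) \<noteq> 0" unfolding q using finY by (auto simp: Y_def)
  have q0: "poly q (x ^ 2) = 0" if "x \<in> S" "x \<noteq> l" "x \<noteq> - l" for x
  proof -
    have "x ^ 2 \<noteq> l ^ 2" using that by (simp add: power2_eq_iff)
    then show ?thesis unfolding q using finY that by (auto simp: Y_def intro!: prod_zero)
  qed
  have "0 = (\<Sum>i\<le>degree q. coeff q i * (\<Sum>x\<in>S. m x * x ^ (2 * i + 1)))"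
  proof -
    have "(\<Sum>x\<in>S. m x * x ^ (2 * i + 1)) = 0" for i by (rule odd0) simp
    then show ?thesis by (simp only: mult_zero_right sum.neutral_const)
  qed
  also have "\<dots> = (\<Sum>x\<in>S. \<Sum>i\<le>degree q. m x * x * (coeff q i * (x ^ 2) ^ i))"
    by (subst sum.swap) (simp add: sum_distrib_left power_mult power_mult_distrib mult_ac flip: power_mult)
  also have "\<dots> = (\<Sum>x\<in>S. m x * x * poly q (x ^ 2))"
    by (simp add: poly_altdef sum_distrib_left)
  also have "\<dots> = (\<Sum>x\<in>{l, - l}. m x * x * poly q (x ^ 2))"
    using S q0 by (intro sum.mono_neutral_right) auto
  also have "\<dots> = (m l - m (- l)) * l * poly q (l ^ 2)"
    using \<open>0 < l\<close> by (simp add: algebra_simps)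
  finally have "m l = m (- l)" using ql \<open>0 < l\<close> by simp
  then show ?thesis by (simp add: m_def)
qed

lemma count_image_mset_uminus: "count (image_mset uminus L) (x :: real) = count L (- x)"
  by (induction L) (auto simp: minus_equation_iff)

text \<open>Apart from \<open>M\<close>, opposite nonzero values occur equally often, and the
  positive ones form \<open>P\<close>. Odd powers do not see zeros; the parity of the sizes makes
  their number even, and half of them go to \<open>L\<close>.\<close>

lemma multiset_partition_of_odd_power_sums:
  fixes X M :: "real multiset"
  assumes sums: "\<And>k. odd k \<Longrightarrow> (\<Sum>x\<in>#X. x ^ k) = (\<Sum>x\<in>#M. x ^ k)"
    and M: "\<And>x. x \<in># M \<Longrightarrow> - x \<notin># M" and even: "even (size X + size M)"
  shows "\<exists>L. X = M + L + image_mset uminus L \<and> (\<forall>x\<in>#L. 0 \<le> x)"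
proof -
  define P where "P = filter_mset (\<lambda>x. 0 < x) (X - M)"
  define z where "z = count X 0"
  note sym = count_symmetric_of_odd_power_sums[OF sums]
  have M0: "count M 0 = 0" using M[of 0] by (metis count_eq_zero_iff minus_zero)
  have MM: "count M x = 0 \<or> count M (- x) = 0" for x
    using M[of x] by (metis count_eq_zero_iff)
  have cP: "count P x = (if 0 < x then count X x - count M x else 0)" for x
    by (simp add: P_def)
  \<comment> \<open>As \<open>M\<close> never contains both \<open>x\<close> and \<open>- x\<close>,
    the subtraction in \<open>cP\<close> is not truncated for positive \<open>x\<close>.\<close>
  have X: "X = M + P + image_mset uminus P + replicate_mset z 0"
  proof (rule multiset_eqI)
    fix x :: real
    consider "0 < x" | "x = 0" | "x < 0" by linarith
    then show "count X x = count (M + P + image_mset uminus P + replicate_mset z 0) x"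
    proof cases
      case 1
      then show ?thesis using sym[of x] MM[of x]
        by (auto simp: cP count_image_mset_uminus)
    next
      case 2
      then show ?thesis using M0 by (simp add: cP count_image_mset_uminus z_def)
    next
      case 3
      then show ?thesis using sym[of "- x"] MM[of x]
        by (auto simp: cP count_image_mset_uminus)
    qed
  qed
  have "size X = size M + 2 * size P + z"
    by (subst X) simp
  then have "even z" using even by auto
  then obtain h where h: "z = h + h" by (metis evenE mult_2)
  define L where "L = P + replicate_mset h 0"
  have "X = M + L + image_mset uminus L"
    by (subst X) (simp add: L_def h multiset_eq_iff)
  moreover have "\<forall>x\<in>#L. 0 \<le> x" by (auto simp: L_def P_def simp del: filter_diff_mset)
  ultimately show ?thesis by blast
qed

section \<open>Spectra of real symmetric matrices\<close>

text \<open>The Hermitian form \<open>q\<close> of an eigenvector equals its own conjugate by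
  symmetry, and it is \<open>l\<close> times the nonzero real number \<open>N\<close>.\<close>

lemma symmetric_mat_eigenvalue_real:
  fixes A :: "real mat"
  assumes A: "A \<in> carrier_mat n n"
    and sym: "\<And>i j. i < n \<Longrightarrow> j < n \<Longrightarrow> A $$ (i, j) = A $$ (j, i)"
    and ev: "eigenvalue (map_mat complex_of_real A) l"
  shows "l \<in> \<real>"
proof -
  let ?C = "map_mat complex_of_real A"
  obtain v where "eigenvector ?C v l" using ev by (auto simp: eigenvalue_def)
  then have v: "v \<in> carrier_vec n" "v \<noteq> 0\<^sub>v n" and Cv: "?C *\<^sub>v v = l \<cdot>\<^sub>v v"
    using A by (auto simp: eigenvector_def)
  define q where "q = (\<Sum>i<n. \<Sum>j<n. cnj (v $ i) * of_real (A $$ (i, j)) * v $ j)"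
  define N where "N = (\<Sum>i<n. (cmod (v $ i))\<^sup>2)"
  have Cvi: "(\<Sum>j<n. of_real (A $$ (i, j)) * v $ j) = l * v $ i" if "i < n" for i
  proof -
    have "(?C *\<^sub>v v) $ i = (\<Sum>j<n. of_real (A $$ (i, j)) * v $ j)"
      using A v that by (simp add: scalar_prod_def atLeast0LessThan)
    then show ?thesis using Cv v that by simp
  qed
  have "q = (\<Sum>i<n. cnj (v $ i) * (\<Sum>j<n. of_real (A $$ (i, j)) * v $ j))"
    by (simp add: q_def sum_distrib_left mult.assoc)
  also have "\<dots> = (\<Sum>i<n. l * (v $ i * cnj (v $ i)))"
    by (intro sum.cong) (simp_all add: Cvi)
  also have "\<dots> = l * of_real N"
    by (simp add: N_def sum_distrib_left flip: complex_norm_square)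
  finally have q: "q = l * of_real N" .
  have "cnj q = (\<Sum>i<n. \<Sum>j<n. cnj (v $ j) * of_real (A $$ (i, j)) * v $ i)"
    by (simp add: q_def mult_ac)
  also have "\<dots> = (\<Sum>j<n. \<Sum>i<n. cnj (v $ j) * of_real (A $$ (i, j)) * v $ i)"
    by (rule sum.swap)
  also have "\<dots> = q"
    unfolding q_def by (intro sum.cong) (simp_all add: sym)
  finally have qr: "cnj q = q" .
  obtain i where i: "i < n" "v $ i \<noteq> 0" using v by (metis carrier_vecD eq_vecI index_zero_vec)
  have "0 < (cmod (v $ i))\<^sup>2" using i by simp
  also have "\<dots> \<le> N" unfolding N_def by (rule member_le_sum) (use i in auto)
  finally have "N \<noteq> 0" by simp
  moreover have "cnj l * of_real N = l * of_real N" using qr q by simp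
  ultimately show ?thesis by (simp add: Reals_cnj_iff)
qed

text \<open>The factorization over the complex numbers has only real roots, and it descends because
  the coefficient embedding is injective.\<close>

lemma symmetric_mat_char_poly_splits:
  fixes A :: "real mat"
  assumes A: "A \<in> carrier_mat n n"
    and sym: "\<And>i j. i < n \<Longrightarrow> j < n \<Longrightarrow> A $$ (i, j) = A $$ (j, i)"
  obtains es where "char_poly A = (\<Prod>e\<leftarrow>es. [:- e, 1:])" "length es = n"
proof -
  interpret map_poly_of_real: map_poly_inj_idom_hom complex_of_real ..
  let ?C = "map_mat complex_of_real A"
  have C: "?C \<in> carrier_mat n n" using A by simp
  obtain as where as: "char_poly ?C = (\<Prod>a\<leftarrow>as. [:- a, 1:])" "length as = n"
    using char_poly_factorized[OF C] by auto
  have real: "a \<in> \<real>" if "a \<in> set as" for a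
  proof -
    have "poly (char_poly ?C) a = 0" unfolding as(1) by (rule linear_poly_root[OF that])
    then show ?thesis
      using symmetric_mat_eigenvalue_real[OF A sym] eigenvalue_root_char_poly[OF C] by blast
  qed
  have "map_poly complex_of_real (\<Prod>e\<leftarrow>map Re as. [:- e, 1:])
      = (\<Prod>e\<leftarrow>map Re as. map_poly complex_of_real [:- e, 1:])"
    by (simp add: map_poly_of_real.hom_prod_list comp_def)
  also have "\<dots> = (\<Prod>a\<leftarrow>as. [:- a, 1:])"
    using real by (auto intro!: arg_cong[of _ _ prod_list] simp: of_real_Re)
  also have "\<dots> = map_poly complex_of_real (char_poly A)"
    using as(1) of_real_hom.char_poly_hom[OF A] by metis
  finally have "char_poly A = (\<Prod>e\<leftarrow>map Re as. [:- e, 1:])"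
    by simp
  then show thesis using that[of "map Re as"] as(2) by simp
qed

section \<open>Traces of powers as power sums of eigenvalues\<close>

definition mat_trace :: "'a :: comm_ring_1 mat \<Rightarrow> 'a" where
  "mat_trace A = (\<Sum>i<dim_row A. A $$ (i, i))"

lemma mat_trace_mult_commute:
  assumes "A \<in> carrier_mat n n" "B \<in> carrier_mat n n"
  shows "mat_trace (A * B) = mat_trace (B * A)"
proof -
  have "mat_trace (A * B) = (\<Sum>i<n. \<Sum>j<n. A $$ (i, j) * B $$ (j, i))"
    using assms by (simp add: mat_trace_def scalar_prod_def atLeast0LessThan)
  also have "\<dots> = (\<Sum>j<n. \<Sum>i<n. B $$ (j, i) * A $$ (i, j))"
    by (subst sum.swap) (simp add: mult.commute)
  also have "\<dots> = mat_trace (B * A)"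
    using assms by (simp add: mat_trace_def scalar_prod_def atLeast0LessThan)
  finally show ?thesis .
qed

lemma upper_triangular_mult:
  fixes A B :: "'a :: comm_ring_1 mat"
  assumes A: "A \<in> carrier_mat n n" "upper_triangular A"
    and B: "B \<in> carrier_mat n n" "upper_triangular B"
  shows "upper_triangular (A * B)"
    and "i < n \<Longrightarrow> (A * B) $$ (i, i) = A $$ (i, i) * B $$ (i, i)"
proof -
  have entry: "(A * B) $$ (i, j) = (\<Sum>k<n. A $$ (i, k) * B $$ (k, j))" if "i < n" "j < n" for i j
    using A B that by (simp add: scalar_prod_def atLeast0LessThan)
  have a0: "A $$ (i, k) = 0" if "k < i" "i < n" for i k using A that by auto
  have b0: "B $$ (k, j) = 0" if "j < k" "k < n" for j k using B that by auto
  show "upper_triangular (A * B)"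
  proof (rule upper_triangularI)
    fix i j assume ij: "j < i" "i < dim_row (A * B)"
    then have "A $$ (i, k) * B $$ (k, j) = 0" if "k < n" for k
      using a0[of k i] b0[of j k] that A by (cases "k < i") auto
    then show "(A * B) $$ (i, j) = 0" using entry[of i j] ij A by simp
  qed
  show "(A * B) $$ (i, i) = A $$ (i, i) * B $$ (i, i)" if i: "i < n" for i
  proof -
    have "(A * B) $$ (i, i) = (\<Sum>k<n. if k = i then A $$ (i, i) * B $$ (i, i) else 0)"
      unfolding entry[OF i i]
      by (rule sum.cong) (use i a0 b0 in \<open>auto simp: neq_iff\<close>)
    then show ?thesis using i by simp
  qed
qed

lemma upper_triangular_pow:
  fixes A :: "'a :: comm_ring_1 mat"
  assumes A: "A \<in> carrier_mat n n" "upper_triangular A"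
  shows "upper_triangular (A ^\<^sub>m k) \<and> (\<forall>i<n. (A ^\<^sub>m k) $$ (i, i) = (A $$ (i, i)) ^ k)"
proof (induction k)
  case (Suc k)
  have "A ^\<^sub>m k \<in> carrier_mat n n" using A by simp
  from upper_triangular_mult[OF this _ A] Suc show ?case by simp
qed (use A in auto)

text \<open>By Schur decomposition \<open>A\<close> is similar to a triangular \<open>B\<close> with
  diagonal \<open>es\<close>; the trace is invariant under similarity, and powers of
  \<open>B\<close> have the powers of \<open>es\<close> on the diagonal.\<close>

lemma mat_trace_pow_eq_sum_eigenvalues:
  fixes A :: "'a :: conjugatable_ordered_field mat"
  assumes A: "A \<in> carrier_mat n n" and es: "char_poly A = (\<Prod>e\<leftarrow>es. [:- e, 1:])"
  shows "mat_trace (A ^\<^sub>m k) = (\<Sum>e\<leftarrow>es. e ^ k)"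
proof -
  obtain B P Q where dec: "schur_decomposition A es = (B, P, Q)" by (metis prod_cases3)
  from schur_decomposition[OF A es dec]
  have wit: "similar_mat_wit A B P Q" and ut: "upper_triangular B" and diag: "diag_mat B = es"
    by auto
  note w = similar_mat_witD2[OF A wit]
  have Bk: "B ^\<^sub>m k \<in> carrier_mat n n" using w by simp
  have "mat_trace (A ^\<^sub>m k) = mat_trace (P * (B ^\<^sub>m k * Q))"
    using similar_mat_wit_pow_id[OF wit, of k] w Bk by (simp add: assoc_mult_mat[of _ n n _ n _ n])
  also have "\<dots> = mat_trace (B ^\<^sub>m k * Q * P)"
    by (rule mat_trace_mult_commute) (use w Bk in auto)
  also have "B ^\<^sub>m k * Q * P = B ^\<^sub>m k"
    using w Bk by (simp add: assoc_mult_mat[of _ n n _ n _ n])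
  also have "mat_trace (B ^\<^sub>m k) = (\<Sum>i<n. (B $$ (i, i)) ^ k)"
    using w(5) upper_triangular_pow[OF w(5) ut, of k] by (simp add: mat_trace_def)
  also have "\<dots> = (\<Sum>e\<leftarrow>es. e ^ k)"
    using w(5) by (simp add: diag[symmetric] diag_mat_def comp_def interv_sum_list_conv_sum_set_nat atLeast0LessThan)
  finally show ?thesis .
qed

lemma proots_prod_list_linear:
  "proots (\<Prod>e\<leftarrow>es. [:- e, 1:]) = mset (es :: 'a :: idom list)"
proof (induction es)
  case (Cons e es)
  have "(\<Prod>e\<leftarrow>es. [:- e, 1:]) \<noteq> (0 :: 'a poly)" by (auto simp: prod_list_zero_iff)
  then show ?case using Cons by (simp add: proots_mult del: mult_pCons_left)
qed simp

lemma symmetric_mat_power_sums: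
  fixes A :: "real mat"
  assumes A: "A \<in> carrier_mat n n"
    and sym: "\<And>i j. i < n \<Longrightarrow> j < n \<Longrightarrow> A $$ (i, j) = A $$ (j, i)"
  shows "size (proots (char_poly A)) = n"
    and "(\<Sum>x\<in>#proots (char_poly A). x ^ k) = mat_trace (A ^\<^sub>m k)"
proof -
  obtain es where es: "char_poly A = (\<Prod>e\<leftarrow>es. [:- e, 1:])" "length es = n"
    using symmetric_mat_char_poly_splits[OF A sym] by blast
  show "size (proots (char_poly A)) = n"
    using es by (simp add: proots_prod_list_linear)
  show "(\<Sum>x\<in>#proots (char_poly A). x ^ k) = mat_trace (A ^\<^sub>m k)"
    unfolding mat_trace_pow_eq_sum_eigenvalues[OF A es(1)] es(1) proots_prod_list_linear
    by (simp flip: sum_mset_sum_list)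
qed

section \<open>Closed walks in fullerenes\<close>

text \<open>The size of a cyclic orbit is the least period. This turns vertex degrees and face
  lengths into relations for \<open>r\<close> and \<open>r \<circ> a\<close>.\<close>

lemma card_orbit:
  assumes "x \<in> orbit f x"
  shows "(f ^^ card (orbit f x)) x = x"
    and "0 < m \<Longrightarrow> m < card (orbit f x) \<Longrightarrow> (f ^^ m) x \<noteq> x"
proof -
  have "card (orbit f x) = funpow_dist1 f x x"
    using orbit_conv_funpow_dist1[OF assms] inj_on_funpow_dist1[OF assms]
    by (metis card_image card_atLeastLessThan diff_zero)
  then show "(f ^^ card (orbit f x)) x = x" "0 < m \<Longrightarrow> m < card (orbit f x) \<Longrightarrow> (f ^^ m) x \<noteq> x"
    using funpow_dist1_prop[OF assms] funpow_dist1_least[of m f x x] by auto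
qed

locale fullerene =
  fixes G :: "('v, 'd) embedded_graph"
  assumes G: "fullerene_036 G"
begin

abbreviation "D \<equiv> darts G"
abbreviation "V \<equiv> verts G"

text \<open>\<^term>\<open>rot G\<close> and \<^term>\<open>opp G\<close> are arbitrary outside the darts, hence the identity is used there.\<close>

definition r :: "'d \<Rightarrow> 'd" where "r d = (if d \<in> D then rot G d else d)"
definition a :: "'d \<Rightarrow> 'd" where "a d = (if d \<in> D then opp G d else d)"

lemma wf: "wf_embedded_graph G"
  and euler: "int (card V) - int (card (edges G)) + int (card (faces G)) = 2"
  and card_darts_at: "v \<in> V \<Longrightarrow> card (darts_at G v) = 3"
  and card_face: "f \<in> faces G \<Longrightarrow> card f = 3 \<or> card f = 6"
  using G by (auto simp: fullerene_036_def plane_graph_def cubic_def)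

lemma finite_V: "finite V" and finite_darts: "finite D"
  and tail_in: "d \<in> D \<Longrightarrow> tail G d \<in> V"
  and a_in: "d \<in> D \<Longrightarrow> a d \<in> D"
  and a_squared: "a (a d) = d"
  and rot_orbit: "d \<in> D \<Longrightarrow> orbit (rot G) d = darts_at G (tail G d)"
  using wf by (auto simp: wf_embedded_graph_def a_def)

lemma tail_r: "tail G (r d) = tail G d"
  and r_in: "d \<in> D \<Longrightarrow> r d \<in> D"
  using orbit.base[of "rot G" d] rot_orbit[of d] by (auto simp: r_def darts_at_def)

lemma r_orbit:
  assumes "d \<in> D"
  shows "orbit r d = darts_at G (tail G d)"
proof -
  have "orbit r d = orbit (rot G) d"
    by (rule orbit_cong0[of d D]) (use assms r_in in \<open>auto simp: r_def\<close>)
  then show ?thesis using rot_orbit[OF assms] by simp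
qed

lemma r_cubed: "r (r (r d)) = d"
  and r_neq: "d \<in> D \<Longrightarrow> r d \<noteq> d" "d \<in> D \<Longrightarrow> r (r d) \<noteq> d"
proof -
  have *: "r (r (r d)) = d \<and> r d \<noteq> d \<and> r (r d) \<noteq> d" if "d \<in> D" for d
  proof -
    have "d \<in> orbit r d" using r_orbit that by (auto simp: darts_at_def)
    note co = card_orbit[OF this]
    have "card (orbit r d) = 3" using r_orbit[OF that] card_darts_at[OF tail_in[OF that]] by simp
    then show ?thesis using co(1) co(2)[of 1] co(2)[of 2] by (simp add: numeral_2_eq_2 numeral_3_eq_3)
  qed
  show "r (r (r d)) = d" using * by (cases "d \<in> D") (auto simp: r_def)
  show "d \<in> D \<Longrightarrow> r d \<noteq> d" "d \<in> D \<Longrightarrow> r (r d) \<noteq> d" using * by auto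
qed

lemma darts_at_eq:
  assumes "d \<in> D"
  shows "darts_at G (tail G d) = {d, r d, r (r d)}" "distinct [d, r d, r (r d)]"
proof -
  have "orbit r d = {(r ^^ m) d | m. m < 3}"
    by (rule orbit_altdef_bounded) (simp_all add: numeral_3_eq_3 r_cubed)
  then show "darts_at G (tail G d) = {d, r d, r (r d)}"
    using r_orbit[OF assms] by (simp add: numeral_3_eq_3 less_Suc_eq ex_disj_distrib conj_disj_distribL) blast
  show "distinct [d, r d, r (r d)]"
    using r_neq[OF assms] r_neq(1)[OF r_in[OF assms]] by (simp add: eq_commute[of d] eq_commute[of "r d" "r (r d)"])
qed

lemma phi_permutes: "(r \<circ> a) permutes D"
proof (rule bij_imp_permutes)
  show "bij_betw (r \<circ> a) D D"
    by (rule bij_betw_byWitness[where f' = "a \<circ> r \<circ> r"])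
       (auto simp: r_cubed a_squared r_in a_in)
qed (simp add: r_def a_def)

lemma phi_orbit:
  assumes "d \<in> D"
  shows "orbit (r \<circ> a) d = orbit (rot G \<circ> opp G) d"
  by (rule orbit_cong0[of d D]) (use assms r_in a_in in \<open>auto simp: r_def a_def\<close>)

lemma faces_eq: "faces G = orbit (r \<circ> a) ` D"
  by (simp add: faces_def phi_orbit)

lemma self_in_face: "d \<in> orbit (r \<circ> a) d"
  by (rule permutation_self_in_orbit) (use phi_permutes finite_darts in \<open>auto simp: permutation_permutes\<close>)

lemma card_orbit_phi: "d \<in> D \<Longrightarrow> card (orbit (r \<circ> a) d) = 3 \<or> card (orbit (r \<circ> a) d) = 6"
  using card_face faces_eq by auto

lemma phi_cubed_iff:
  assumes "d \<in> D"
  shows "((r \<circ> a) ^^ 3) d = d \<longleftrightarrow> card (orbit (r \<circ> a) d) = 3"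
  using card_orbit_phi[OF assms] card_orbit(1)[OF self_in_face, of d] card_orbit(2)[OF self_in_face, of 3 d]
  by auto

text \<open>Both face lengths divide 6 and neither is 1; outside the darts both maps are the
  identity.\<close>

sublocale hexagonal_action D r a
proof
  fix d
  have "((r \<circ> a) ^^ 6) d = d" if "d \<in> D"
  proof (cases "card (orbit (r \<circ> a) d) = 3")
    case True
    then have "((r \<circ> a) ^^ 3) d = d" using phi_cubed_iff that by simp
    then have "((r \<circ> a) ^^ (3 + 3)) d = d" by (simp only: funpow_add comp_apply)
    then show ?thesis by simp
  next
    case False
    then show ?thesis using card_orbit_phi[OF that] card_orbit(1)[OF self_in_face, of d] by simp
  qed
  moreover have "((r \<circ> a) ^^ 6) d = d" if "d \<notin> D"
    using that by (simp add: numeral_eq_Suc r_def a_def)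
  ultimately show "((r \<circ> a) ^^ 6) d = d" by blast
  show "r (a d) \<noteq> d" if "d \<in> D"
    using card_orbit(2)[OF self_in_face, of 1 d] card_orbit_phi[OF that] by auto
qed (simp_all add: finite_darts r_in a_in r_cubed a_squared)

lemma semiedges_eq: "semiedges G = fixed_points D a"
  by (auto simp: semiedges_def fixed_points_def a_def)

section \<open>Faces and Euler's formula\<close>

lemma face_disjoint:
  assumes "f \<in> faces G" "g \<in> faces G" "f \<noteq> g"
  shows "f \<inter> g = {}"
proof (rule ccontr)
  assume "f \<inter> g \<noteq> {}"
  then obtain x where x: "x \<in> f" "x \<in> g" by blast
  have "h = orbit (r \<circ> a) x" if h: "h \<in> faces G" "x \<in> h" for h
  proof -
    obtain d where "h = orbit (r \<circ> a) d" using h(1) faces_eq by auto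
    then show ?thesis using orbit_swap[OF self_in_face, of x d] orbit_trans h(2) by fast
  qed
  then show False using x assms by blast
qed

lemma card_darts_in_faces:
  "card {d \<in> D. card (orbit (r \<circ> a) d) = c} = c * card {f \<in> faces G. card f = c}"
proof -
  have sub: "orbit (r \<circ> a) d \<subseteq> D" if "d \<in> D" for d
    using permutes_orbit_subset[OF phi_permutes that] .
  have orb: "orbit (r \<circ> a) x = orbit (r \<circ> a) d" if "x \<in> orbit (r \<circ> a) d" "d \<in> D" for x d
  proof (rule ccontr)
    assume "orbit (r \<circ> a) x \<noteq> orbit (r \<circ> a) d"
    moreover have "x \<in> D" using sub that by blast
    ultimately show False
      using face_disjoint[of "orbit (r \<circ> a) x" "orbit (r \<circ> a) d"] self_in_face[of x] that faces_eq by blast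
  qed
  have U: "\<Union>{f \<in> faces G. card f = c} = {d \<in> D. card (orbit (r \<circ> a) d) = c}" (is "?L = ?R")
  proof (intro equalityI subsetI)
    fix x assume "x \<in> ?L"
    then obtain d where "d \<in> D" "x \<in> orbit (r \<circ> a) d" "card (orbit (r \<circ> a) d) = c"
      using faces_eq by auto
    then show "x \<in> ?R" using sub orb by auto
  next
    fix x assume "x \<in> ?R"
    then show "x \<in> ?L" using self_in_face[of x] faces_eq by auto
  qed
  have "c * card {f \<in> faces G. card f = c} = card (\<Union>{f \<in> faces G. card f = c})"
  proof (rule card_partition)
    show "finite {f \<in> faces G. card f = c}" using finite_darts faces_eq by simp
    show "finite (\<Union>{f \<in> faces G. card f = c})" unfolding U using finite_darts by simp
  qed (auto dest: face_disjoint)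
  then show ?thesis using U by simp
qed

lemma sum_darts: "(\<Sum>v\<in>V. \<Sum>d\<in>darts_at G v. g d) = (\<Sum>d\<in>D. g d :: 'b :: comm_monoid_add)"
  unfolding darts_at_def
  by (rule sum.group) (auto simp: finite_V finite_darts tail_in)

lemma card_darts: "card D = 3 * card V"
  using sum_darts[of "\<lambda>_. 1 :: nat"] card_darts_at by (simp add: sum.cong)

text \<open>With \<open>f3\<close> triangles and \<open>f6\<close> hexagons, the darts are counted
  in three ways: by vertices, by faces, and by edges with semiedges.\<close>

lemma counts:
  obtains f3 f6 where "card (fixed_points D ((r \<circ> a) ^^ 3)) = 3 * f3"
    "card (semiedges G) + f3 = 4" "card V = f3 + 2 * f6"
proof -
  define f3 f6 where "f3 = card {f \<in> faces G. card f = 3}" and "f6 = card {f \<in> faces G. card f = 6}"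
  have fin: "finite (faces G)" using faces_eq finite_darts by simp
  have F: "card (faces G) = f3 + f6"
  proof -
    have "faces G = {f \<in> faces G. card f = 3} \<union> {f \<in> faces G. card f = 6}" using card_face by auto
    then show ?thesis unfolding f3_def f6_def
      by (subst card_Un_disjoint[symmetric]) (use fin in auto)
  qed
  have fix3: "card (fixed_points D ((r \<circ> a) ^^ 3)) = 3 * f3"
  proof -
    have "fixed_points D ((r \<circ> a) ^^ 3) = {d \<in> D. card (orbit (r \<circ> a) d) = 3}"
      using phi_cubed_iff by (auto simp: fixed_points_def)
    then show ?thesis by (simp add: card_darts_in_faces f3_def)
  qed
  have D36: "card D = 3 * f3 + 6 * f6"
  proof -
    have "D = {d \<in> D. card (orbit (r \<circ> a) d) = 3} \<union> {d \<in> D. card (orbit (r \<circ> a) d) = 6}"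
      using card_orbit_phi by auto
    then have "card D = card {d \<in> D. card (orbit (r \<circ> a) d) = 3} + card {d \<in> D. card (orbit (r \<circ> a) d) = 6}"
      by (subst card_Un_disjoint[symmetric]) (use finite_darts in auto)
    then show ?thesis by (simp only: card_darts_in_faces f3_def f6_def)
  qed
  have "edges G = {{x, a x} | x. x \<in> D \<and> a x \<noteq> x}"
    unfolding edges_def a_def by auto
  then have E: "card D = 2 * card (edges G) + card (semiedges G)"
    using card_involution[OF finite_darts a_in a_squared] by (simp add: semiedges_eq)
  show thesis
    \<comment> \<open>Doubling Euler's formula and eliminating the edges gives
      \<open>s - V + 2 * F = 4\<close>, where \<open>V = f3 + 2 * f6\<close> and
      \<open>F = f3 + f6\<close>.\<close>
    using that[OF fix3, of f6] F D36 E euler card_darts by linarith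
qed

section \<open>Powers of the adjacency matrix and closed walks\<close>

definition vert :: "nat \<Rightarrow> 'v" where "vert = from_nat_into V"

lemma vert_bij: "bij_betw vert {..<card V} V"
  unfolding vert_def by (rule bij_betw_from_nat_into_finite[OF finite_V])

lemma sum_vert: "(\<Sum>i<card V. g (vert i)) = (\<Sum>v\<in>V. g v :: 'b :: comm_monoid_add)"
  by (rule sum.reindex_bij_betw[OF vert_bij])

abbreviation "A \<equiv> adjacency_matrix G"

lemma A_carrier: "A \<in> carrier_mat (card V) (card V)"
  by (simp add: adjacency_matrix_def)

lemma A_entry:
  assumes "i < card V" "j < card V"
  shows "A $$ (i, j) = real (card {d \<in> darts_at G (vert i). tail G (a d) = vert j})"
proof -
  have "{d \<in> darts_at G (vert i). tail G (opp G d) = vert j} = {d \<in> darts_at G (vert i). tail G (a d) = vert j}"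
    by (auto simp: darts_at_def a_def)
  then show ?thesis using assms by (simp add: adjacency_matrix_def vert_def)
qed

lemma A_symmetric:
  assumes "i < card V" "j < card V"
  shows "A $$ (i, j) = A $$ (j, i)"
proof -
  have "bij_betw a {d \<in> darts_at G (vert i). tail G (a d) = vert j} {d \<in> darts_at G (vert j). tail G (a d) = vert i}"
    by (rule bij_betw_byWitness[where f' = a]) (auto simp: darts_at_def a_squared a_in)
  from bij_betw_same_card[OF this] show ?thesis by (simp add: A_entry assms)
qed

lemma tail_half_turn: "tail G (half_turn p d) = tail G (a ((r ^^ p) d))"
proof -
  have "tail G ((r ^^ n) e) = tail G e" for n e by (induction n) (auto simp: tail_r)
  then show ?thesis by (simp add: half_turn_def)
qed

text \<open>The half-turns applied to \<open>d\<close> traverse the three darts at its tail, one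
  each; their final rotation stays at the vertex reached. Hence words of length \<open>k\<close>
  label the walks of length \<open>k\<close> starting from \<open>d\<close>.\<close>

lemma A_row:
  assumes "d \<in> D" "tail G d = vert i" "i < card V" "j < card V"
  shows "A $$ (i, j) = (\<Sum>p<3. of_bool (tail G (half_turn p d) = vert j))"
proof -
  have da: "darts_at G (vert i) = {d, r d, r (r d)}" and dist: "distinct [d, r d, r (r d)]"
    using darts_at_eq[OF assms(1)] assms(2) by auto
  have "A $$ (i, j) = (\<Sum>x\<in>{d, r d, r (r d)}. of_bool (tail G (a x) = vert j))"
    using A_entry[OF assms(3,4)] da by (simp add: of_bool_def sum.If_cases Int_def)
  also have "\<dots> = (\<Sum>p<3. of_bool (tail G (half_turn p d) = vert j))"
    using dist by (simp add: tail_half_turn numeral_3_eq_3)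
  finally show ?thesis .
qed

lemma A_pow:
  assumes "d \<in> D" "tail G d = vert i" "i < card V" "j < card V"
  shows "(A ^\<^sub>m k) $$ (i, j) = (\<Sum>w\<in>words k. of_bool (tail G (half_turns w d) = vert j))"
  using assms(4)
proof (induction k arbitrary: j)
  case 0
  have "words 0 = {[]}" by (auto simp: words_def)
  moreover have "vert i = vert j \<longleftrightarrow> i = j"
    using vert_bij assms(3) 0 by (auto simp: bij_betw_def inj_on_def)
  ultimately show ?case using assms(2,3) 0 A_carrier by auto
next
  case (Suc k)
  let ?n = "card V"
  have Ak: "A ^\<^sub>m k \<in> carrier_mat ?n ?n" using A_carrier by simp
  have "(A ^\<^sub>m Suc k) $$ (i, j) = (\<Sum>l<?n. (A ^\<^sub>m k) $$ (i, l) * A $$ (l, j))"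
    using Ak A_carrier assms(3) Suc.prems by (simp add: scalar_prod_def atLeast0LessThan)
  also have "\<dots> = (\<Sum>l<?n. \<Sum>w\<in>words k. of_bool (tail G (half_turns w d) = vert l) * A $$ (l, j))"
    by (simp add: Suc.IH sum_distrib_right)
  \<comment> \<open>Where the indicator is nonzero, the dart reached by \<open>w\<close> lies at
    \<open>vert l\<close>, and \<open>A_row\<close> at that dart expands the entry of
    \<open>A\<close>.\<close>
  also have "\<dots> = (\<Sum>l<?n. \<Sum>w\<in>words k. of_bool (tail G (half_turns w d) = vert l) *
      (\<Sum>p<3. of_bool (tail G (half_turns (w @ [p]) d) = vert j)))"
  proof (intro sum.cong refl)
    fix l w assume "l \<in> {..<?n}"
    then show "of_bool (tail G (half_turns w d) = vert l) * A $$ (l, j)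
        = of_bool (tail G (half_turns w d) = vert l) * (\<Sum>p<3. of_bool (tail G (half_turns (w @ [p]) d) = vert j))"
      using A_row[of "half_turns w d" l j] half_turns_in[OF assms(1)] Suc.prems by auto
  qed
  also have "\<dots> = (\<Sum>w\<in>words k. (\<Sum>l<?n. of_bool (tail G (half_turns w d) = vert l)) *
      (\<Sum>p<3. of_bool (tail G (half_turns (w @ [p]) d) = vert j)))"
    by (subst sum.swap) (simp only: sum_distrib_right)
  also have "\<dots> = (\<Sum>w\<in>words k. \<Sum>p<3. of_bool (tail G (half_turns (w @ [p]) d) = vert j))"
  proof (intro sum.cong refl)
    fix w
    have "(\<Sum>l<?n. of_bool (tail G (half_turns w d) = vert l)) = (\<Sum>v\<in>V. of_bool (tail G (half_turns w d) = v) :: real)"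
      by (rule sum_vert)
    also have "\<dots> = 1"
      using finite_V tail_in[OF half_turns_in[OF assms(1)]] by (simp add: of_bool_def)
    finally show "(\<Sum>l<?n. of_bool (tail G (half_turns w d) = vert l)) *
      (\<Sum>p<3. of_bool (tail G (half_turns (w @ [p]) d) = vert j))
        = (\<Sum>p<3. of_bool (tail G (half_turns (w @ [p]) d) = vert j) :: real)"
      by simp
  qed
  finally show ?case by (simp only: sum_words_Suc)
qed

text \<open>Each closed walk is counted from every dart at its starting vertex, hence the factor 3
  in the proof.\<close>

lemma trace_A_pow:
  assumes "odd k"
  shows "mat_trace (A ^\<^sub>m k) = 3 ^ k - 3 + real (card (semiedges G))"
proof -
  let ?n = "card V"
  have "3 * mat_trace (A ^\<^sub>m k) = (\<Sum>i<?n. 3 * (A ^\<^sub>m k) $$ (i, i))"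
    using A_carrier by (simp add: mat_trace_def sum_distrib_left)
  also have "\<dots> = (\<Sum>i<?n. \<Sum>d\<in>darts_at G (vert i). \<Sum>w\<in>words k. of_bool (tail G (half_turns w d) = tail G d))"
  proof (intro sum.cong refl)
    fix i assume i: "i \<in> {..<?n}"
    then have "vert i \<in> V" using vert_bij by (auto simp: bij_betw_def)
    then have c: "card (darts_at G (vert i)) = 3" by (rule card_darts_at)
    have "(\<Sum>d\<in>darts_at G (vert i). \<Sum>w\<in>words k. of_bool (tail G (half_turns w d) = tail G d))
        = (\<Sum>d\<in>darts_at G (vert i). (A ^\<^sub>m k) $$ (i, i))"
      using A_pow[of _ i i k] i by (intro sum.cong refl) (auto simp: darts_at_def)
    then show "3 * (A ^\<^sub>m k) $$ (i, i)
        = (\<Sum>d\<in>darts_at G (vert i). \<Sum>w\<in>words k. of_bool (tail G (half_turns w d) = tail G d))"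
      using c by simp
  qed
  also have "\<dots> = (\<Sum>v\<in>V. \<Sum>d\<in>darts_at G v. \<Sum>w\<in>words k. of_bool (tail G (half_turns w d) = tail G d))"
    by (rule sum_vert)
  also have "\<dots> = (\<Sum>d\<in>D. \<Sum>w\<in>words k. of_bool (tail G (half_turns w d) = tail G d))"
    by (rule sum_darts)
  \<comment> \<open>The darts at the tail of \<open>d\<close> are \<open>d\<close>,
    \<open>r d\<close> and \<open>r (r d)\<close>, and the last two are out of reach for words of
    odd length.\<close>
  also have "\<dots> = (\<Sum>d\<in>D. \<Sum>w\<in>words k. of_bool (half_turns w d = d))"
  proof (intro sum.cong refl)
    fix d w assume d: "d \<in> D" and w: "w \<in> words k"
    have "tail G (half_turns w d) = tail G d \<longleftrightarrow> half_turns w d \<in> darts_at G (tail G d)"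
      using half_turns_in[OF d] by (simp add: darts_at_def)
    also have "\<dots> \<longleftrightarrow> half_turns w d = d"
      using half_turns_neq_r[of w d] w d assms by (auto simp: darts_at_eq words_def)
    finally show "of_bool (tail G (half_turns w d) = tail G d) = (of_bool (half_turns w d = d) :: real)"
      by simp
  qed
  also have "\<dots> = real (\<Sum>w\<in>words k. card (fixed_points D (half_turns w)))"
    by (subst sum.swap) (simp add: fixed_points_def of_bool_def sum.If_cases finite_darts Int_def)
  finally have tr: "3 * mat_trace (A ^\<^sub>m k) = real (\<Sum>w\<in>words k. card (fixed_points D (half_turns w)))" .
  obtain f3 f6 where f: "card (fixed_points D ((r \<circ> a) ^^ 3)) = 3 * f3" "card (semiedges G) + f3 = 4"
    by (rule counts)
  define s where "s = int (card (semiedges G))"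
  \<comment> \<open>Each triangle carries three fixed darts, and there are \<open>4 - s\<close>
    triangles.\<close>
  have f3: "int (3 * f3) = 12 - 3 * s" using f(2) by (simp add: s_def)
  have "4 * int (\<Sum>w\<in>words k. card (fixed_points D (half_turns w)))
      = 4 * 3 ^ k * s + (12 - 3 * s - s) * (3 ^ k - 3)"
    using sum_card_fixed_half_turns[OF assms] unfolding f(1) f3 semiedges_eq[symmetric] s_def by simp
  also have "\<dots> = 12 * (3 ^ k - 3 + s)" by (simp add: algebra_simps)
  finally have "int (\<Sum>w\<in>words k. card (fixed_points D (half_turns w))) = 3 * (3 ^ k - 3 + s)" by simp
  then have "real_of_int (int (\<Sum>w\<in>words k. card (fixed_points D (half_turns w)))) = real_of_int (3 * (3 ^ k - 3 + s))"
    by (rule arg_cong)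
  then show ?thesis using tr by (simp add: s_def)
qed

text \<open>Reduces each case of the classification to a check of the odd power sums and the size of
  an explicit \<open>M\<close>.\<close>

lemma spectrum_partition:
  assumes sums: "\<And>k. odd k \<Longrightarrow> (\<Sum>x\<in>#M. x ^ k) = 3 ^ k - 3 + real (card (semiedges G))"
    and M: "\<And>x. x \<in># M \<Longrightarrow> - x \<notin># M" and even: "even (card V + size M)"
  shows "\<exists>L. graph_spectrum G = M + L + image_mset uminus L \<and> (\<forall>x\<in>#L. 0 \<le> x)"
  unfolding graph_spectrum_def
proof (rule multiset_partition_of_odd_power_sums)
  note ps = symmetric_mat_power_sums[OF A_carrier A_symmetric]
  show "(\<Sum>x\<in>#proots (char_poly A). x ^ k) = (\<Sum>x\<in>#M. x ^ k)" if "odd k" for k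
    using ps(2)[of k] trace_A_pow[OF that] sums[OF that] by simp
  show "even (size (proots (char_poly A)) + size M)" using ps(1) even by simp
qed (rule M)

end

theorem theorem4:
  fixes G :: "('v, 'd) embedded_graph" and s :: nat
  assumes "fullerene_036 G"
    and "s = card (semiedges G)"
  shows "\<exists>M L :: real multiset.
           graph_spectrum G = M + L + image_mset uminus L \<and>
           (\<forall>x\<in>#L. 0 \<le> x) \<and>
           ((s = 0 \<and> M = {#3, -1, -1, -1#}) \<or>
            (s = 2 \<and> M = {#3, -1#}) \<or>
            (s = 3 \<and> M = {#3#}) \<or>
            (s = 4 \<and> M = {#3, 1#}))"
proof -
  interpret fullerene G by (unfold_locales) (rule assms(1))
  obtain f3 f6 where f: "s + f3 = 4" "card (verts G) = f3 + 2 * f6"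
    using counts assms(2) by metis
  have "s \<noteq> 1" using card_fixed_a_neq_1 assms(2) semiedges_eq by simp
  then consider "s = 0" | "s = 2" | "s = 3" | "s = 4" using f(1) by linarith
  then show ?thesis
  proof cases
    case 1
    \<comment> \<open>In every case the members of \<open>M\<close> other than 3 are 1 or -1 and add
      up to \<open>s - 3\<close>, as do their odd powers. The number of vertices has the parity of
      \<open>f3 = 4 - s\<close>, hence of \<open>s\<close>, which is also that of the size of
      \<open>M\<close>.\<close>
    have "\<exists>L. graph_spectrum G = {#3, -1, -1, -1#} + L + image_mset uminus L \<and> (\<forall>x\<in>#L. 0 \<le> x)"
      by (rule spectrum_partition) (use 1 f assms(2) in auto)
    then show ?thesis using 1 by blast
  next
    case 2
    have "\<exists>L. graph_spectrum G = {#3, -1#} + L + image_mset uminus L \<and> (\<forall>x\<in>#L. 0 \<le> x)"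
      by (rule spectrum_partition) (use 2 f assms(2) in auto)
    then show ?thesis using 2 by blast
  next
    case 3
    have "\<exists>L. graph_spectrum G = {#3#} + L + image_mset uminus L \<and> (\<forall>x\<in>#L. 0 \<le> x)"
      by (rule spectrum_partition) (use 3 f assms(2) in auto)
    then show ?thesis using 3 by blast
  next
    case 4
    have "\<exists>L. graph_spectrum G = {#3, 1#} + L + image_mset uminus L \<and> (\<forall>x\<in>#L. 0 \<le> x)"
      by (rule spectrum_partition) (use 4 f assms(2) in auto)
    then show ?thesis using 4 by blast
  qed
qed

end
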